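(* Let $X$ be a non-locally convex quasi-Banach space and let $I=[0,1]$. Then $\mathcal{C}^{(1)}_{\mathrm{Kal}}(I,X)\subsetneqq\mathcal{C}^{(1)}_{\mathrm{Lip}}(I,X)$; that is, the inclusion of $\mathcal{C}^{(1)}_{\mathrm{Kal}}(I,X)$ in $\mathcal{C}^{(1)}_{\mathrm{Lip}}(I,X)$ is strict.
   Context: Quasi-Banach spaces are real: $X$ is a real vector space with a complete quasi-norm $\|\cdot\|$ (i.e. $\|x\|>0$ for $x\ne0$, $\|\alpha x\|=|\alpha|\|x\|$, $\|x+y\|\le\kappa(\|x\|+\|y\|)$ for some constant $\kappa\ge1$), with the vector topology induced by the quasi-norm; $X$ is non-locally convex if this topology is not locally convex (equivalently, $X$ is not isomorphic to a Banach space). $\mathcal{C}^{(1)}(I,X)$ is the space of all continuously differentiable functions $f:I\to X$ with $f(0)=0$ (the derivative $f'(t)$ is the limit in $X$ of the difference quotients, one-sided at the endpoints, and $f'$ is required to exist everywhere on $I$ and be continuous). $\mathcal{C}^{(1)}_{\mathrm{Lip}}(I,X)$ is the set of all $f\in\mathcal{C}^{(1)}(I,X)$ which are Lipschitz, i.e. with $\|f\|_{\mathrm{Lip}}=\sup_{0\le s<t\le1}\frac{\|f(t)-f(s)\|}{t-s}<\infty$. $\mathcal{C}^{(1)}_{\mathrm{Kal}}(I,X)$ is the set of all $f\in\mathcal{C}^{(1)}_{\mathrm{Lip}}(I,X)$ such that the function $g:I^2\to X$ given by $g(s,t)=\frac{f(s)-f(t)}{s-t}$ for $s\ne t$ and $g(t,t)=f'(t)$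 is (jointly) continuous on $I^2$. *)

theory Defs
  imports "HOL-Analysis.Analysis"
begin

definition quasi_norm :: "('a::real_vector \<Rightarrow> real) \<Rightarrow> bool" where
  "quasi_norm q \<longleftrightarrow>
     (\<forall>x. x \<noteq> 0 \<longrightarrow> 0 < q x) \<and>
     (\<forall>a x. q (a *\<^sub>R x) = \<bar>a\<bar> * q x) \<and>
     (\<exists>\<kappa>\<ge>1. \<forall>x y. q (x + y) \<le> \<kappa> * (q x + q y))"

text \<open>
  A quasi-norm need not be continuous, so a ball need not be open; it is nevertheless
  a neighbourhood of its centre (see the lemma on limits below).
\<close>

definition quasi_topology :: "('a::real_vector \<Rightarrow> real) \<Rightarrow> 'a topology" where
  "quasi_topology q = topology (\<lambda>U. \<forall>x\<in>U. \<exists>e>0. \<forall>y. q (y - x) < e \<longrightarrow> y \<in> U)"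

lemma openin_quasi_topology:
  "openin (quasi_topology q) U \<longleftrightarrow> (\<forall>x\<in>U. \<exists>e>0. \<forall>y. q (y - x) < e \<longrightarrow> y \<in> U)"
proof -
  have "istopology (\<lambda>U. \<forall>x\<in>U. \<exists>e>0. \<forall>y. q (y - x) < e \<longrightarrow> y \<in> U)"
    unfolding istopology_def
  proof (intro conjI allI impI)
    fix S T :: "'a set"
    assume S: "\<forall>x\<in>S. \<exists>e>0. \<forall>y. q (y - x) < e \<longrightarrow> y \<in> S"
      and T: "\<forall>x\<in>T. \<exists>e>0. \<forall>y. q (y - x) < e \<longrightarrow> y \<in> T"
    show "\<forall>x\<in>S \<inter> T. \<exists>e>0. \<forall>y. q (y - x) < e \<longrightarrow> y \<in> S \<inter> T"
    proof
      fix x assume "x \<in> S \<inter> T"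
      then obtain d e where "d > 0" "\<forall>y. q (y - x) < d \<longrightarrow> y \<in> S"
        "e > 0" "\<forall>y. q (y - x) < e \<longrightarrow> y \<in> T"
        using S T by blast
      then show "\<exists>e>0. \<forall>y. q (y - x) < e \<longrightarrow> y \<in> S \<inter> T"
        by (intro exI[of _ "min d e"]) auto
    qed
  next
    fix K :: "'a set set"
    assume "\<forall>S\<in>K. \<forall>x\<in>S. \<exists>e>0. \<forall>y. q (y - x) < e \<longrightarrow> y \<in> S"
    then show "\<forall>x\<in>\<Union>K. \<exists>e>0. \<forall>y. q (y - x) < e \<longrightarrow> y \<in> \<Union>K"
      by (meson UnionE UnionI)
  qed
  then show ?thesis
    unfolding quasi_topology_def by (simp add: topology_inverse')
qed

lemma topspace_quasi_topology [simp]: "topspace (quasi_topology q) = UNIV"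
proof -
  have "openin (quasi_topology q) UNIV"
    unfolding openin_quasi_topology by (auto intro: exI[of _ 1])
  then show ?thesis
    using openin_subset by blast
qed

lemma limitin_quasi_topology:
  assumes "quasi_norm q"
  shows "limitin (quasi_topology q) f l F \<longleftrightarrow> (\<forall>e>0. \<forall>\<^sub>F x in F. q (f x - l) < e)"
proof
  obtain k where k: "k \<ge> 1" "\<And>x y. q (x + y) \<le> k * (q x + q y)"
    and hom: "\<And>a x. q (a *\<^sub>R x) = \<bar>a\<bar> * q x"
    using assms unfolding quasi_norm_def by metis
  have q0: "q 0 = 0"
    using hom[of 0 0] by simp
  assume L: "limitin (quasi_topology q) f l F"
  show "\<forall>e>0. \<forall>\<^sub>F x in F. q (f x - l) < e"
  proof (intro allI impI)
    fix e :: real assume "e > 0"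
    define U where "U = {x. \<exists>d>0. \<forall>y. q (y - x) < d \<longrightarrow> q (y - l) < e}"
    have "openin (quasi_topology q) U"
      unfolding openin_quasi_topology
    proof
      fix x assume "x \<in> U"
      then obtain d where d: "d > 0" "\<And>y. q (y - x) < d \<Longrightarrow> q (y - l) < e"
        unfolding U_def by blast
      have "y \<in> U" if y: "q (y - x) < d / (2 * k)" for y
      proof -
        have "q (z - l) < e" if z: "q (z - y) < d / (2 * k)" for z
        proof -
          have "q (z - x) \<le> k * (q (z - y) + q (y - x))"
            using k(2)[of "z - y" "y - x"] by simp
          also have "\<dots> < k * (d / (2 * k) + d / (2 * k))"
            using y z k(1) by (intro mult_strict_left_mono add_strict_mono) auto
          also have "\<dots> = d" using k(1) by (simp add: field_simps)
          finally show ?thesis by (rule d(2))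
        qed
        moreover have "d / (2 * k) > 0" using d(1) k(1) by simp
        ultimately show ?thesis unfolding U_def by blast
      qed
      moreover have "d / (2 * k) > 0" using d(1) k(1) by simp
      ultimately show "\<exists>e>0. \<forall>y. q (y - x) < e \<longrightarrow> y \<in> U" by blast
    qed
    moreover have "l \<in> U" unfolding U_def using \<open>e > 0\<close> by blast
    ultimately have "\<forall>\<^sub>F x in F. f x \<in> U" using L unfolding limitin_def by blast
    then show "\<forall>\<^sub>F x in F. q (f x - l) < e"
    proof (rule eventually_mono)
      fix x assume "f x \<in> U"
      then show "q (f x - l) < e" unfolding U_def using q0 by force
    qed
  qed
next
  assume R: "\<forall>e>0. \<forall>\<^sub>F x in F. q (f x - l) < e"
  show "limitin (quasi_topology q) f l F"
    unfolding limitin_def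
  proof (intro conjI allI impI)
    fix U assume "openin (quasi_topology q) U \<and> l \<in> U"
    then obtain e where "e > 0" "\<And>y. q (y - l) < e \<Longrightarrow> y \<in> U"
      unfolding openin_quasi_topology by blast
    then show "\<forall>\<^sub>F x in F. f x \<in> U"
      using R eventually_mono[of "\<lambda>x. q (f x - l) < e" F "\<lambda>x. f x \<in> U"] by blast
  qed simp
qed

definition quasi_Banach :: "('a::real_vector \<Rightarrow> real) \<Rightarrow> bool" where
  "quasi_Banach q \<longleftrightarrow> quasi_norm q \<and>
     (\<forall>x :: nat \<Rightarrow> 'a. (\<forall>e>0. \<exists>N. \<forall>m\<ge>N. \<forall>n\<ge>N. q (x m - x n) < e)
        \<longrightarrow> (\<exists>l. limitin (quasi_topology q) x l sequentially))"

definition locally_convex :: "'a::real_vector topology \<Rightarrow> bool" where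
  "locally_convex T \<longleftrightarrow> neighbourhood_base_of convex T"

text \<open>
  The derivative on \<open>[0,1]\<close>; the filter \<open>at t within {0..1}\<close> makes it one-sided
  at the endpoints. For a quasi-norm the topology is Hausdorff, so \<open>THE\<close> below is
  determined whenever a derivative exists.
\<close>

definition has_quasi_derivative ::
    "('a::real_vector \<Rightarrow> real) \<Rightarrow> (real \<Rightarrow> 'a) \<Rightarrow> 'a \<Rightarrow> real \<Rightarrow> bool" where
  "has_quasi_derivative q f D t \<longleftrightarrow>
     limitin (quasi_topology q) (\<lambda>s. (f s - f t) /\<^sub>R (s - t)) D (at t within {0..1})"

definition quasi_deriv :: "('a::real_vector \<Rightarrow> real) \<Rightarrow> (real \<Rightarrow> 'a) \<Rightarrow> real \<Rightarrow> 'a" where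
  "quasi_deriv q f t = (THE D. has_quasi_derivative q f D t)"

text \<open>Functions on \<open>[0,1]\<close> are total functions that are \<open>undefined\<close> outside \<open>[0,1]\<close>.\<close>

definition C1 :: "('a::real_vector \<Rightarrow> real) \<Rightarrow> (real \<Rightarrow> 'a) set" where
  "C1 q = {f \<in> {0..1} \<rightarrow>\<^sub>E UNIV. f 0 = 0 \<and>
     (\<forall>t\<in>{0..1}. \<exists>D. has_quasi_derivative q f D t) \<and>
     continuous_map (top_of_set {0..1}) (quasi_topology q) (quasi_deriv q f)}"

definition C1_Lip :: "('a::real_vector \<Rightarrow> real) \<Rightarrow> (real \<Rightarrow> 'a) set" where
  "C1_Lip q = {f \<in> C1 q.
     bdd_above {q (f t - f s) / (t - s) | s t. 0 \<le> s \<and> s < t \<and> t \<le> 1}}"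

definition diff_quotient ::
    "('a::real_vector \<Rightarrow> real) \<Rightarrow> (real \<Rightarrow> 'a) \<Rightarrow> real \<times> real \<Rightarrow> 'a" where
  "diff_quotient q f = (\<lambda>(s, t). if s = t then quasi_deriv q f t else (f s - f t) /\<^sub>R (s - t))"

definition C1_Kal :: "('a::real_vector \<Rightarrow> real) \<Rightarrow> (real \<Rightarrow> 'a) set" where
  "C1_Kal q = {f \<in> C1_Lip q.
     continuous_map (top_of_set ({0..1} \<times> {0..1})) (quasi_topology q) (diff_quotient q f)}"

end

theory Submission
  imports Defs
begin

text \<open>
  Convex combinations of vectors of quasi-norm less than \<open>1\<close> are unbounded, and each of them is the
  endpoint of a \<open>C\<^sup>1\<close> curve on \<open>[0,1]\<close> of speed at most \<open>2\<close>, obtained by traversing the vectors one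
  after the other. Returning to the origin along such a curve and dividing by the Lipschitz constant,
  which is huge, gives bumps with Lipschitz constant \<open>1\<close> and derivative at most \<open>\<epsilon>\<close>, some difference
  quotient of which is still at least \<open>1/2\<close>. A sum of such bumps with \<open>\<epsilon> \<rightarrow> 0\<close> on disjoint intervals
  \<open>[a\<^sub>n, a\<^sub>n + a\<^sub>n\<^sup>2]\<close> shrinking to \<open>0\<close> is continuously differentiable with derivative \<open>0\<close> at \<open>0\<close>, and
  Lipschitz, while its difference quotient does not tend to \<open>0\<close> at \<open>(0,0)\<close>.
\<close>

section \<open>Limits with respect to a quasi-norm\<close>

locale quasi_normed =
  fixes q :: "'a::real_vector \<Rightarrow> real" and k :: real
  assumes k_ge_1: "1 \<le> k"
    and q_pos: "x \<noteq> 0 \<Longrightarrow> 0 < q x"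
    and q_scaleR: "q (a *\<^sub>R x) = \<bar>a\<bar> * q x"
    and q_add: "q (x + y) \<le> k * (q x + q y)"
begin

lemma quasi_norm: "quasi_norm q"
  unfolding quasi_norm_def using k_ge_1 q_pos q_scaleR q_add by blast

lemma q_0 [simp]: "q 0 = 0"
  using q_scaleR[of 0 0] by simp

lemma q_nonneg [simp]: "0 \<le> q x"
  using q_pos[of x] by (cases "x = 0") auto

lemma q_minus [simp]: "q (- x) = q x"
  using q_scaleR[of "-1" x] by simp

lemma q_minus_commute: "q (x - y) = q (y - x)"
  using q_minus[of "x - y"] by simp

lemma q_diff: "q (x - y) \<le> k * (q x + q y)"
  using q_add[of x "- y"] by simp

text \<open>Convergence becomes a real limit, so sandwiching and the \<open>tendsto\<close> rules
  apply. Since \<open>q\<close> need not be continuous, arguments go through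
  \<open>q (g s - l)\<close> rather than \<open>q (g s)\<close>.\<close>

definition qlim :: "('b \<Rightarrow> 'a) \<Rightarrow> 'a \<Rightarrow> 'b filter \<Rightarrow> bool" where
  "qlim g l F \<longleftrightarrow> ((\<lambda>s. q (g s - l)) \<longlongrightarrow> 0) F"

lemma limitin_iff_qlim: "limitin (quasi_topology q) g l F \<longleftrightarrow> qlim g l F"
  unfolding limitin_quasi_topology[OF quasi_norm] qlim_def tendsto_iff by simp

lemma qlim_add:
  assumes "qlim g l F" "qlim h m F"
  shows "qlim (\<lambda>s. g s + h s) (l + m) F"
  unfolding qlim_def
proof (rule tendsto_sandwich[of "\<lambda>s. 0"])
  show "((\<lambda>s. k * (q (g s - l) + q (h s - m))) \<longlongrightarrow> 0) F"
    using assms unfolding qlim_def by (auto intro!: tendsto_eq_intros)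
  show "\<forall>\<^sub>F s in F. q (g s + h s - (l + m)) \<le> k * (q (g s - l) + q (h s - m))"
    using q_add[of "g s - l" "h s - m" for s] by (simp add: algebra_simps)
qed auto

lemma qlim_scaleR:
  assumes "qlim g l F"
  shows "qlim (\<lambda>s. c *\<^sub>R g s) (c *\<^sub>R l) F"
  using tendsto_mult_left[OF assms[unfolded qlim_def], of "\<bar>c\<bar>"]
  by (simp add: qlim_def q_scaleR flip: scaleR_diff_right)

lemma qlim_const: "qlim (\<lambda>s. l) l F"
  unfolding qlim_def by simp

lemma qlim_compose: "qlim g l G \<Longrightarrow> filterlim h G F \<Longrightarrow> qlim (\<lambda>s. g (h s)) l F"
  unfolding qlim_def by (rule filterlim_compose)

lemma qlim_cong:
  assumes "\<forall>\<^sub>F s in F. g s = h s" "l = m"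
  shows "qlim g l F \<longleftrightarrow> qlim h m F"
  unfolding qlim_def assms(2)
  by (intro filterlim_cong refl eventually_mono[OF assms(1)]) simp

lemma qlim_mono: "qlim g l F \<Longrightarrow> G \<le> F \<Longrightarrow> qlim g l G"
  unfolding qlim_def by (rule tendsto_mono)

lemma qlim_unique:
  assumes "qlim g l F" "qlim g m F" "F \<noteq> bot"
  shows "l = m"
proof (rule ccontr)
  assume "l \<noteq> m"
  have "q (m - l) \<le> 0"
  proof (rule tendsto_lowerbound)
    show "((\<lambda>s. k * (q (g s - l) + q (g s - m))) \<longlongrightarrow> 0) F"
      using assms unfolding qlim_def by (auto intro!: tendsto_eq_intros)
    show "\<forall>\<^sub>F s in F. q (m - l) \<le> k * (q (g s - l) + q (g s - m))"
      using q_diff[of "g s - l" "g s - m" for s] by simp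
  qed fact
  then show False using q_pos[of "m - l"] \<open>l \<noteq> m\<close> by simp
qed

section \<open>Lipschitz continuously differentiable maps on the real line\<close>

text \<open>The Lipschitz bound is a separate clause because without local convexity a bound on
  \<open>f'\<close> does not control the difference quotients. Two-sided limits on the whole line
  avoid endpoint cases.\<close>

definition Lip_C1 :: "(real \<Rightarrow> 'a) \<Rightarrow> (real \<Rightarrow> 'a) \<Rightarrow> bool" where
  "Lip_C1 f f' \<longleftrightarrow> (\<exists>L. \<forall>s t. q (f t - f s) \<le> L * \<bar>t - s\<bar>) \<and>
     (\<forall>t. qlim (\<lambda>s. (f s - f t) /\<^sub>R (s - t)) (f' t) (at t)) \<and> (\<forall>t. qlim f' (f' t) (at t))"

lemma Lip_C1_0: "Lip_C1 (\<lambda>t. 0) (\<lambda>t. 0)"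
  unfolding Lip_C1_def by (auto intro!: exI[of _ 0] simp: qlim_const)

lemma Lip_C1_add:
  assumes "Lip_C1 f f'" "Lip_C1 g g'"
  shows "Lip_C1 (\<lambda>t. f t + g t) (\<lambda>t. f' t + g' t)"
proof -
  obtain L M where L: "\<And>s t. q (f t - f s) \<le> L * \<bar>t - s\<bar>" and M: "\<And>s t. q (g t - g s) \<le> M * \<bar>t - s\<bar>"
    using assms unfolding Lip_C1_def by blast
  have "q (f t + g t - (f s + g s)) \<le> k * (L + M) * \<bar>t - s\<bar>" for s t
  proof -
    have "q (f t + g t - (f s + g s)) \<le> k * (q (f t - f s) + q (g t - g s))"
      using q_add[of "f t - f s" "g t - g s"] by (simp add: algebra_simps)
    also have "\<dots> \<le> k * (L * \<bar>t - s\<bar> + M * \<bar>t - s\<bar>)"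
      using k_ge_1 L M by (intro mult_left_mono add_mono) auto
    finally show ?thesis by (simp add: algebra_simps)
  qed
  moreover have "qlim (\<lambda>s. (f s + g s - (f t + g t)) /\<^sub>R (s - t)) (f' t + g' t) (at t)" for t
    using qlim_add[of "\<lambda>s. (f s - f t) /\<^sub>R (s - t)" "f' t" "at t" "\<lambda>s. (g s - g t) /\<^sub>R (s - t)" "g' t"] assms
    unfolding Lip_C1_def by (simp add: algebra_simps)
  ultimately show ?thesis
    using assms unfolding Lip_C1_def by (blast intro: qlim_add)
qed

lemma Lip_C1_sum:
  "(\<And>i. i \<in> A \<Longrightarrow> Lip_C1 (f i) (f' i)) \<Longrightarrow> Lip_C1 (\<lambda>t. \<Sum>i\<in>A. f i t) (\<lambda>t. \<Sum>i\<in>A. f' i t)"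
  by (induction A rule: infinite_finite_induct) (auto simp: Lip_C1_0 Lip_C1_add)

lemma Lip_C1_scaleR:
  assumes "Lip_C1 f f'"
  shows "Lip_C1 (\<lambda>t. c *\<^sub>R f t) (\<lambda>t. c *\<^sub>R f' t)"
proof -
  obtain L where L: "\<And>s t. q (f t - f s) \<le> L * \<bar>t - s\<bar>"
    using assms unfolding Lip_C1_def by blast
  have "q (c *\<^sub>R f t - c *\<^sub>R f s) \<le> (\<bar>c\<bar> * L) * \<bar>t - s\<bar>" for s t
    using mult_left_mono[OF L[of t s], of "\<bar>c\<bar>"] by (simp add: q_scaleR mult.assoc flip: scaleR_diff_right)
  moreover have "qlim (\<lambda>s. (c *\<^sub>R f s - c *\<^sub>R f t) /\<^sub>R (s - t)) (c *\<^sub>R f' t) (at t)" for t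
    using qlim_scaleR[of "\<lambda>s. (f s - f t) /\<^sub>R (s - t)" "f' t" "at t" c] assms
    unfolding Lip_C1_def by (simp add: algebra_simps)
  ultimately show ?thesis
    using assms unfolding Lip_C1_def by (blast intro: qlim_scaleR)
qed

lemma Lip_C1_affine:
  assumes "Lip_C1 f f'" "c \<noteq> 0"
  shows "Lip_C1 (\<lambda>t. f (c * t + d)) (\<lambda>t. c *\<^sub>R f' (c * t + d))"
proof -
  obtain L where L: "\<And>s t. q (f t - f s) \<le> L * \<bar>t - s\<bar>"
    using assms unfolding Lip_C1_def by blast
  have "q (f (c * t + d) - f (c * s + d)) \<le> (L * \<bar>c\<bar>) * \<bar>t - s\<bar>" for s t
    using L[of "c * t + d" "c * s + d"] by (simp add: mult.assoc flip: abs_mult right_diff_distrib)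
  \<comment> \<open>As \<open>c \<noteq> 0\<close>, the affine map is injective and sends punctured
    neighbourhoods into punctured ones.\<close>
  moreover have lim: "filterlim (\<lambda>s. c * s + d) (at (c * t + d)) (at t)" for t
    using assms(2) by (auto simp: filterlim_at eventually_at intro!: tendsto_eq_intros exI[of _ 1])
  have "qlim (\<lambda>s. (f (c * s + d) - f (c * t + d)) /\<^sub>R (s - t)) (c *\<^sub>R f' (c * t + d)) (at t)" for t
  proof -
    have "qlim (\<lambda>s. (f s - f (c * t + d)) /\<^sub>R (s - (c * t + d))) (f' (c * t + d)) (at (c * t + d))"
      using assms unfolding Lip_C1_def by blast
    from qlim_scaleR[OF qlim_compose[OF this lim], of c] show ?thesis
      using assms(2) by (simp add: mult.assoc[symmetric] flip: right_diff_distrib)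
  qed
  moreover have "qlim (\<lambda>t. c *\<^sub>R f' (c * t + d)) (c *\<^sub>R f' (c * t + d)) (at t)" for t
  proof -
    have "qlim f' (f' (c * t + d)) (at (c * t + d))"
      using assms unfolding Lip_C1_def by blast
    from qlim_scaleR[OF qlim_compose[OF this lim], of c] show ?thesis .
  qed
  ultimately show ?thesis
    unfolding Lip_C1_def by blast
qed

text \<open>Along a fixed direction everything reduces to the scalar factor, for which the mean
  value inequality does turn a derivative bound into a Lipschitz bound.\<close>

lemma Lip_C1_line:
  fixes \<phi> \<phi>' :: "real \<Rightarrow> real"
  assumes der: "\<And>t. (\<phi> has_real_derivative \<phi>' t) (at t)"
    and cont: "\<And>t. isCont \<phi>' t" and bound: "\<And>t. \<bar>\<phi>' t\<bar> \<le> B"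
  shows "Lip_C1 (\<lambda>t. \<phi> t *\<^sub>R x) (\<lambda>t. \<phi>' t *\<^sub>R x)"
proof -
  have "\<bar>\<phi> t - \<phi> s\<bar> \<le> B * \<bar>t - s\<bar>" for s t
    using field_differentiable_bound[of UNIV \<phi> \<phi>' B t s] der bound by simp
  then have "q (\<phi> t *\<^sub>R x - \<phi> s *\<^sub>R x) \<le> (B * q x) * \<bar>t - s\<bar>" for s t
    using mult_right_mono[of "\<bar>\<phi> t - \<phi> s\<bar>" "B * \<bar>t - s\<bar>" "q x"]
    by (simp add: q_scaleR mult_ac flip: scaleR_diff_left)
  moreover have line: "qlim (\<lambda>s. g s *\<^sub>R x) (c *\<^sub>R x) F" if "(g \<longlongrightarrow> c) F" for g :: "real \<Rightarrow> real" and c F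
    using tendsto_mult_right[OF tendsto_rabs[OF tendsto_diff[OF that tendsto_const[of c]]], of "q x"]
    by (simp add: qlim_def q_scaleR flip: scaleR_diff_left)
  have "qlim (\<lambda>s. (\<phi> s *\<^sub>R x - \<phi> t *\<^sub>R x) /\<^sub>R (s - t)) (\<phi>' t *\<^sub>R x) (at t)" for t
    using line[OF der[of t, unfolded has_field_derivative_iff]]
    by (simp add: divide_inverse mult.commute flip: scaleR_diff_left)
  moreover have "qlim (\<lambda>s. \<phi>' s *\<^sub>R x) (\<phi>' t *\<^sub>R x) (at t)" for t
    using line[OF cont[of t, unfolded isCont_def]] .
  ultimately show ?thesis
    unfolding Lip_C1_def by blast
qed

section \<open>Curves of bounded speed and their endpoints\<close>

text \<open>Resting outside \<open>[0,1]\<close>, with derivative \<open>0\<close> at both ends,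
  lets curves be run one after the other. No bound is put on \<open>f 1\<close>: it is to become
  large while the speed stays at most \<open>2\<close>.\<close>

definition curve :: "(real \<Rightarrow> 'a) \<Rightarrow> (real \<Rightarrow> 'a) \<Rightarrow> bool" where
  "curve f f' \<longleftrightarrow> Lip_C1 f f' \<and> (\<forall>t\<le>0. f t = 0 \<and> f' t = 0) \<and> (\<forall>t\<ge>1. f t = f 1 \<and> f' t = 0) \<and>
     (\<forall>t. q (f' t) \<le> 2)"

lemma curveD:
  assumes "curve f f'"
  shows "Lip_C1 f f'" "t \<le> 0 \<Longrightarrow> f t = 0" "t \<le> 0 \<Longrightarrow> f' t = 0"
    "t \<ge> 1 \<Longrightarrow> f t = f 1" "t \<ge> 1 \<Longrightarrow> f' t = 0" "q (f' t) \<le> 2"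
  using assms unfolding curve_def by blast+

lemma curve_line:
  assumes "q x < 1"
  obtains f f' where "curve f f'" "f 1 = x"
proof -
  \<comment> \<open>\<open>\<phi>\<close> is a \<open>C\<^sup>1\<close> step from \<open>0\<close> to \<open>1\<close> whose derivative is the tent of height \<open>2\<close> over \<open>[0,1]\<close>.\<close>
  define p where "p t = (max 0 t)\<^sup>2" for t :: real
  have p: "(p has_real_derivative 2 * max 0 t) (at t)" for t
  proof -
    consider "t < 0" | "t = 0" | "t > 0" by linarith
    then show ?thesis
    proof cases
      case 1
      have "((\<lambda>t. 0) has_real_derivative 2 * max 0 t) (at t)"
        using 1 by simp
      then show ?thesis
        by (rule has_field_derivative_transform_within_open[where S = "{..<0}"])
          (use 1 in \<open>auto simp: p_def\<close>)
    next
      case 2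
      have "((\<lambda>s. p s / s) \<longlongrightarrow> 0) (at 0)"
      proof (rule Lim_null_comparison)
        show "\<forall>\<^sub>F s in at 0. norm (p s / s) \<le> \<bar>s\<bar>"
          by (auto simp: p_def max_def power2_eq_square)
        show "((\<lambda>s::real. \<bar>s\<bar>) \<longlongrightarrow> 0) (at 0)"
          by (auto intro!: tendsto_eq_intros)
      qed
      then show ?thesis
        using 2 by (simp add: has_field_derivative_iff p_def)
    next
      case 3
      have "((\<lambda>t. t\<^sup>2) has_real_derivative 2 * max 0 t) (at t)"
        using 3 by (auto intro!: derivative_eq_intros)
      then show ?thesis
        by (rule has_field_derivative_transform_within_open[where S = "{0<..}"])
          (use 3 in \<open>auto simp: p_def\<close>)
    qed
  qed
  have p_shift: "((\<lambda>t. p (t - c)) has_real_derivative 2 * max 0 (t - c)) (at t)" for c t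
    using DERIV_shift[of p "2 * max 0 (t - c)" t "- c"] p[of "t - c"] by simp
  \<comment> \<open>The tent is a second difference of ramps with step \<open>1/2\<close>; its
    primitive is the same second difference of \<open>p\<close>, whose derivative is twice a ramp.
    The outer factor makes the final value \<open>1\<close>.\<close>
  define \<phi> where "\<phi> t = 2 * (p t - 2 * p (t - 1/2) + p (t - 1))" for t
  define \<phi>' where "\<phi>' t = 4 * (max 0 t - 2 * max 0 (t - 1/2) + max 0 (t - 1))" for t :: real
  have der: "(\<phi> has_real_derivative \<phi>' t) (at t)" for t
    unfolding \<phi>_def[abs_def] \<phi>'_def
    by (auto intro!: derivative_eq_intros p p_shift)
  have cont: "isCont \<phi>' t" for t
    unfolding \<phi>'_def[abs_def] by (intro continuous_intros)
  have bound: "\<bar>\<phi>' t\<bar> \<le> 2" for t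
    unfolding \<phi>'_def by (simp add: max_def abs_if)
  have "\<phi> t = 1" if "t \<ge> 1" for t
    using that by (simp add: \<phi>_def p_def power2_eq_square algebra_simps)
  moreover have "\<phi>' t = 0" if "t \<ge> 1" for t
    using that by (simp add: \<phi>'_def)
  moreover have "\<phi> t = 0 \<and> \<phi>' t = 0" if "t \<le> 0" for t
    using that by (simp add: \<phi>_def \<phi>'_def p_def)
  moreover have "\<bar>\<phi>' t\<bar> * q x \<le> 2" for t
    using mult_mono[OF bound[of t], of "q x" 1] assms by simp
  ultimately have "curve (\<lambda>t. \<phi> t *\<^sub>R x) (\<lambda>t. \<phi>' t *\<^sub>R x)"
    unfolding curve_def using Lip_C1_line[OF der cont bound] by (simp add: q_scaleR)
  moreover have "\<phi> 1 *\<^sub>R x = x"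
    using \<open>\<And>t. 1 \<le> t \<Longrightarrow> \<phi> t = 1\<close> by simp
  ultimately show ?thesis by (rule that)
qed

text \<open>The weights serve as durations: scaling time and values by the same factor preserves
  speed. The two pieces never move simultaneously, so the speed bound survives without a factor
  \<open>k\<close>, however often curves are concatenated.\<close>

lemma curve_concat:
  assumes f: "curve f f'" and g: "curve g g'" and ab: "0 < a" "0 < b" "a + b = 1"
  shows "curve (\<lambda>t. a *\<^sub>R f (t / a) + b *\<^sub>R g ((t - a) / b)) (\<lambda>t. f' (t / a) + g' ((t - a) / b))"
    (is "curve ?h ?h'")
proof -
  have "Lip_C1 f f'" "Lip_C1 g g'"
    using f g by (auto dest: curveD(1))
  then have "Lip_C1 (\<lambda>t. a *\<^sub>R f (1/a * t + 0) + b *\<^sub>R g (1/b * t + (- a / b)))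
     (\<lambda>t. a *\<^sub>R ((1/a) *\<^sub>R f' (1/a * t + 0)) + b *\<^sub>R ((1/b) *\<^sub>R g' (1/b * t + (- a / b))))"
    using ab by (intro Lip_C1_add Lip_C1_scaleR Lip_C1_affine) auto
  then have "Lip_C1 ?h ?h'"
    using ab by (simp add: diff_divide_distrib)
  moreover have "?h t = 0 \<and> ?h' t = 0" if "t \<le> 0" for t
  proof -
    have "t / a \<le> 0" "(t - a) / b \<le> 0" using that ab by (auto simp: divide_nonpos_pos)
    then show ?thesis using curveD(2,3)[OF f] curveD(2,3)[OF g] by simp
  qed
  moreover have end_val: "?h t = a *\<^sub>R f 1 + b *\<^sub>R g 1 \<and> ?h' t = 0" if "t \<ge> 1" for t
  proof -
    have "t / a \<ge> 1" "(t - a) / b \<ge> 1" using that ab by (auto simp: field_simps)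
    then show ?thesis
      using curveD(4,5)[OF f, of "t / a"] curveD(4,5)[OF g, of "(t - a) / b"] by simp
  qed
  moreover have "q (?h' t) \<le> 2" for t
  proof (cases "t \<le> a")
    case True
    then have "(t - a) / b \<le> 0" using ab by (auto simp: divide_nonpos_pos)
    then show ?thesis using curveD(3)[OF g] curveD(6)[OF f] by simp
  next
    case False
    then have "t / a \<ge> 1" using ab by (auto simp: field_simps)
    then show ?thesis using curveD(5)[OF f] curveD(6)[OF g] by simp
  qed
  ultimately show ?thesis
    unfolding curve_def using end_val[of 1] by simp
qed

text \<open>Concatenation with the weights as durations ends at the convex combination. Zero weights
  are treated apart, since the weights occur as divisors.\<close>

lemma convex_curve_endpoints: "convex {f 1 | f f'. curve f f'}"
proof (rule convexI)
  fix x y :: 'a and a b :: real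
  assume "x \<in> {f 1 | f f'. curve f f'}" "y \<in> {f 1 | f f'. curve f f'}"
    and ab: "0 \<le> a" "0 \<le> b" "a + b = 1"
  then obtain f f' g g' where fg: "curve f f'" "x = f 1" "curve g g'" "y = g 1"
    by blast
  show "a *\<^sub>R x + b *\<^sub>R y \<in> {f 1 | f f'. curve f f'}"
  proof (cases "a = 0 \<or> b = 0")
    case True
    then show ?thesis using fg ab by auto
  next
    case False
    with ab have pos: "0 < a" "0 < b" by auto
    let ?h = "\<lambda>t. a *\<^sub>R f (t / a) + b *\<^sub>R g ((t - a) / b)"
    \<comment> \<open>At time \<open>1\<close> the first piece is evaluated at \<open>1 / a\<close>,
      where it already rests at its endpoint.\<close>
    have "1 / a \<ge> 1" "1 - a = b" using ab pos by auto
    then have "?h 1 = a *\<^sub>R x + b *\<^sub>R y"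
      using curveD(4)[OF fg(1), of "1 / a"] fg pos by simp
    then show ?thesis
      using curve_concat[OF fg(1) fg(3) pos ab(3)] by (metis (mono_tags, lifting) mem_Collect_eq)
  qed
qed

section \<open>Local convexity and the convex hull of the unit ball\<close>

text \<open>Translated multiples of the hull are convex neighbourhoods, and a bound on the hull
  makes them as small as required.\<close>

lemma locally_convex_if_bounded_hull:
  assumes bound: "\<And>x. x \<in> convex hull {x. q x < 1} \<Longrightarrow> q x \<le> M"
  shows "locally_convex (quasi_topology q)"
  unfolding locally_convex_def neighbourhood_base_of
proof (intro allI impI)
  fix W x
  assume W: "openin (quasi_topology q) W \<and> x \<in> W"
  then obtain e where e: "0 < e" "\<And>y. q (y - x) < e \<Longrightarrow> y \<in> W"
    unfolding openin_quasi_topology by blast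
  \<comment> \<open>The maximum with \<open>1\<close> gives a positive divisor; the factor
    \<open>2\<close> in \<open>r\<close> yields a strict inequality.\<close>
  define M' where "M' = max M 1"
  define r where "r = e / (2 * M')"
  have M': "M' \<ge> 1" "M \<le> M'" and r: "r > 0"
    using e by (auto simp: M'_def r_def)
  define V where "V = (\<lambda>z. x + r *\<^sub>R z) ` (convex hull {x. q x < 1})"
  \<comment> \<open>Balls need not be open, so the open set required inside \<open>V\<close> is its
    interior, described by balls.\<close>
  define U where "U = {y. \<exists>d>0. \<forall>z. q (z - y) < d \<longrightarrow> z \<in> V}"
  have "convex V"
    unfolding V_def by (intro convex_affinity convex_convex_hull)
  moreover have "V \<subseteq> W"
  proof
    fix y assume "y \<in> V"
    then obtain z where z: "z \<in> convex hull {x. q x < 1}" "y = x + r *\<^sub>R z"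
      unfolding V_def by blast
    have "q (y - x) = r * q z"
      using z r by (simp add: q_scaleR)
    also have "\<dots> \<le> r * M'"
      using bound[OF z(1)] M' r by (intro mult_left_mono) auto
    also have "\<dots> < e"
      using e M' by (simp add: r_def)
    finally show "y \<in> W" by (rule e(2))
  qed
  moreover have "x \<in> U"
  proof -
    have "z \<in> V" if "q (z - x) < r" for z
    proof -
      have "q ((1/r) *\<^sub>R (z - x)) < 1"
        unfolding q_scaleR using that r by simp
      then have "(1/r) *\<^sub>R (z - x) \<in> convex hull {x. q x < 1}"
        by (simp add: hull_inc)
      then show ?thesis
        unfolding V_def using r by (intro image_eqI) auto
    qed
    then show ?thesis unfolding U_def using r by blast
  qed
  moreover have "U \<subseteq> V"
    unfolding U_def using q_0 by force
  moreover have "openin (quasi_topology q) U"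
    unfolding openin_quasi_topology
  proof
    fix y assume "y \<in> U"
    then obtain d where d: "d > 0" "\<And>z. q (z - y) < d \<Longrightarrow> z \<in> V"
      unfolding U_def by blast
    have "w \<in> U" if w: "q (w - y) < d / (2 * k)" for w
    proof -
      have "z \<in> V" if z: "q (z - w) < d / (2 * k)" for z
      proof (rule d(2))
        have "q (z - y) \<le> k * (q (z - w) + q (w - y))"
          using q_add[of "z - w" "w - y"] by simp
        also have "\<dots> < k * (d / (2 * k) + d / (2 * k))"
          using w z k_ge_1 by (intro mult_strict_left_mono add_strict_mono) auto
        also have "\<dots> = d" using k_ge_1 by (simp add: field_simps)
        finally show "q (z - y) < d" .
      qed
      moreover have "d / (2 * k) > 0" using d k_ge_1 by simp
      ultimately show ?thesis unfolding U_def by blast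
    qed
    moreover have "d / (2 * k) > 0" using d k_ge_1 by simp
    ultimately show "\<exists>e>0. \<forall>z. q (z - y) < e \<longrightarrow> z \<in> U" by blast
  qed
  ultimately show "\<exists>U V. openin (quasi_topology q) U \<and> convex V \<and> x \<in> U \<and> U \<subseteq> V \<and> V \<subseteq> W"
    by blast
qed

text \<open>The set of endpoints is convex and contains the vectors of quasi-norm below
  \<open>1\<close>, hence their convex hull, which is unbounded when local convexity fails.\<close>

lemma long_curve:
  assumes "\<not> locally_convex (quasi_topology q)"
  obtains f f' where "curve f f'" "q (f 1) > M"
proof -
  have "convex hull {x. q x < 1} \<subseteq> {f 1 | f f'. curve f f'}"
  proof (rule hull_minimal)
    show "{x. q x < 1} \<subseteq> {f 1 | f f'. curve f f'}"
    proof
      fix x assume "x \<in> {x. q x < 1}"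
      then obtain f f' where "curve f f'" "f 1 = x"
        using curve_line[of x] by blast
      then show "x \<in> {f 1 | f f'. curve f f'}" by blast
    qed
  qed (rule convex_curve_endpoints)
  moreover obtain x where "x \<in> convex hull {x. q x < 1}" "q x > M"
    using locally_convex_if_bounded_hull[of M] assms by fastforce
  ultimately show ?thesis using that by blast
qed

section \<open>Bumps with small derivative and large difference quotients\<close>

lemma unit_bump:
  assumes "\<not> locally_convex (quasi_topology q)" "0 < \<epsilon>"
  obtains f f' where "Lip_C1 f f'" "\<And>t. t \<notin> {0<..<1} \<Longrightarrow> f t = 0 \<and> f' t = 0"
    "\<And>t. q (f' t) \<le> \<epsilon>" "\<And>s t. q (f t - f s) \<le> \<bar>t - s\<bar>"
    "\<exists>s t. 0 \<le> s \<and> s < t \<and> t \<le> 1 \<and> (t - s) / 2 \<le> q (f t - f s)"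
proof -
  \<comment> \<open>The bump \<open>g\<close> below has speed at most \<open>4\<close>, and its
    optimal Lipschitz constant \<open>L\<close> is at least \<open>2 * q (c 1)\<close>; this
    threshold therefore gives \<open>4 / L\<close> at most \<open>\<epsilon>\<close>.\<close>
  obtain c c' where c: "curve c c'" "q (c 1) > 4 / \<epsilon>"
    using long_curve[OF assms(1)] .
  \<comment> \<open>Up to time \<open>1/2\<close> only the first term moves, out to
    \<open>c 1\<close>; afterwards only the second moves, cancelling it. Running twice as fast
    doubles the speed bound to \<open>4\<close>.\<close>
  define g where "g t = c (2 * t) - c (2 * t - 1)" for t
  define g' where "g' t = 2 *\<^sub>R c' (2 * t) - 2 *\<^sub>R c' (2 * t - 1)" for t
  have "Lip_C1 c c'" by (rule curveD(1)[OF c(1)])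
  then have "Lip_C1 (\<lambda>t. c (2 * t + 0) + (-1) *\<^sub>R c (2 * t + (-1)))
      (\<lambda>t. 2 *\<^sub>R c' (2 * t + 0) + (-1) *\<^sub>R (2 *\<^sub>R c' (2 * t + (-1))))"
    by (intro Lip_C1_add Lip_C1_scaleR Lip_C1_affine) auto
  then have smooth: "Lip_C1 g g'"
    by (simp add: g_def[abs_def] g'_def[abs_def])
  have zero: "g t = 0 \<and> g' t = 0" if "t \<notin> {0<..<1}" for t
  proof (cases "t \<le> 0")
    case True
    then show ?thesis using curveD(2,3)[OF c(1)] by (simp add: g_def g'_def)
  next
    case False
    then have "2 * t \<ge> 1" "2 * t - 1 \<ge> 1" using that by auto
    then have "c (2 * t) = c 1 \<and> c' (2 * t) = 0" "c (2 * t - 1) = c 1 \<and> c' (2 * t - 1) = 0"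
      using curveD(4,5)[OF c(1)] by blast+
    then show ?thesis unfolding g_def g'_def by simp
  qed
  have speed: "q (g' t) \<le> 4" for t
  proof (cases "t \<le> 1/2")
    case True
    then have "c' (2 * t - 1) = 0" "q (c' (2 * t)) \<le> 2" using curveD(3,6)[OF c(1)] by auto
    then show ?thesis unfolding g'_def by (simp add: q_scaleR)
  next
    case False
    then have "c' (2 * t) = 0" "q (c' (2 * t - 1)) \<le> 2" using curveD(5,6)[OF c(1)] by auto
    then show ?thesis unfolding g'_def by (simp add: q_scaleR)
  qed
  define Q where "Q = {q (g t - g s) / (t - s) | s t. 0 \<le> s \<and> s < t \<and> t \<le> 1}"
  obtain L0 where L0: "\<And>s t. q (g t - g s) \<le> L0 * \<bar>t - s\<bar>"
    using smooth unfolding Lip_C1_def by blast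
  have bdd: "bdd_above Q"
    unfolding Q_def
  proof (rule bdd_aboveI[of _ L0], clarify)
    fix s t :: real assume "s < t"
    then show "q (g t - g s) / (t - s) \<le> L0"
      using L0[of t s] by (simp add: pos_divide_le_eq)
  qed
  \<comment> \<open>Dividing by the optimal constant, not just by some Lipschitz constant, keeps a
    difference quotient above \<open>1/2\<close>.\<close>
  define L where "L = Sup Q"
  have "q (g (1/2) - g 0) / (1/2 - 0) \<in> Q"
    unfolding Q_def by (intro CollectI exI[of _ 0] exI[of _ "1/2"]) auto
  then have mem: "2 * q (c 1) \<in> Q"
    using curveD(2)[OF c(1)] by (simp add: g_def mult.commute)
  have "2 * q (c 1) \<le> L"
    unfolding L_def by (rule cSup_upper[OF mem bdd])
  then have L: "L > 0" "4 / \<epsilon> \<le> L"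
    using c(2) assms(2) q_nonneg[of "c 1"] divide_pos_pos[of 4 \<epsilon>] by linarith+
  have Lip_ord: "q (g t - g s) \<le> L * (t - s)" if "0 \<le> s" "s \<le> t" "t \<le> 1" for s t
  proof (cases "s = t")
    case False
    then have "q (g t - g s) / (t - s) \<le> L"
      unfolding L_def using that False by (intro cSup_upper[OF _ bdd]) (force simp: Q_def)
    then show ?thesis using that False by (simp add: pos_divide_le_eq)
  qed simp
  have Lip_unit: "q (g t - g s) \<le> L * \<bar>t - s\<bar>" if "s \<in> {0..1}" "t \<in> {0..1}" for s t
    using Lip_ord[of s t] Lip_ord[of t s] that q_minus_commute[of "g t" "g s"] by (cases "s \<le> t") auto
  have Lip: "q (g t - g s) \<le> L * \<bar>t - s\<bar>" for s t
  proof -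
    \<comment> \<open>Clamping to \<open>[0,1]\<close> does not increase distances, and it leaves
      \<open>g\<close> unchanged because \<open>g\<close> vanishes at and beyond the
      endpoints.\<close>
    define r where "r t = max 0 (min 1 t)" for t :: real
    have "g t = g (r t)" for t
      using zero[of t] zero[of "r t"] by (cases "t \<in> {0<..<1}") (auto simp: r_def max_def min_def)
    then have "q (g t - g s) \<le> L * \<bar>r t - r s\<bar>"
      using Lip_unit[of "r s" "r t"] by (simp add: r_def)
    also have "\<dots> \<le> L * \<bar>t - s\<bar>"
      using L by (intro mult_left_mono) (auto simp: r_def max_def min_def)
    finally show ?thesis .
  qed
  have "L / 2 < Sup Q" using L unfolding L_def by simp
  then obtain z where "z \<in> Q" "L / 2 < z"
    using less_cSup_iff[OF _ bdd] mem by blast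
  then obtain s t where st: "0 \<le> s" "s < t" "t \<le> 1" "L / 2 < q (g t - g s) / (t - s)"
    unfolding Q_def by blast
  have diff: "q ((1/L) *\<^sub>R g t - (1/L) *\<^sub>R g s) = q (g t - g s) / L" for s t
    using L by (simp add: q_scaleR flip: scaleR_diff_right)
  show ?thesis
  proof (rule that)
    show "Lip_C1 (\<lambda>t. (1/L) *\<^sub>R g t) (\<lambda>t. (1/L) *\<^sub>R g' t)"
      by (intro Lip_C1_scaleR smooth)
    show "(1/L) *\<^sub>R g t = 0 \<and> (1/L) *\<^sub>R g' t = 0" if "t \<notin> {0<..<1}" for t
      using zero[OF that] by simp
    show "q ((1/L) *\<^sub>R g' t) \<le> \<epsilon>" for t
    proof -
      have "q ((1/L) *\<^sub>R g' t) \<le> 4 / L"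
        unfolding q_scaleR using L speed[of t] by (simp add: divide_right_mono)
      also have "\<dots> \<le> \<epsilon>"
        using L assms(2) by (simp add: field_simps)
      finally show ?thesis .
    qed
    show "q ((1/L) *\<^sub>R g t - (1/L) *\<^sub>R g s) \<le> \<bar>t - s\<bar>" for s t
      unfolding diff using Lip[of t s] L by (simp add: pos_divide_le_eq mult.commute)
    show "\<exists>s t. 0 \<le> s \<and> s < t \<and> t \<le> 1 \<and> (t - s) / 2 \<le> q ((1/L) *\<^sub>R g t - (1/L) *\<^sub>R g s)"
      unfolding diff using st L by (intro exI[of _ s] exI[of _ t]) (simp add: field_simps)
  qed
qed

text \<open>Scaling time and values by the same factor \<open>l\<close> leaves derivatives and
  difference quotients unchanged.\<close>

lemma bump:
  assumes "\<not> locally_convex (quasi_topology q)" "0 < \<epsilon>" "0 < l"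
  obtains f f' where "Lip_C1 f f'" "\<And>t. t \<notin> {a<..<a + l} \<Longrightarrow> f t = 0 \<and> f' t = 0"
    "\<And>t. q (f' t) \<le> \<epsilon>" "\<And>s t. q (f t - f s) \<le> \<bar>t - s\<bar>"
    "\<exists>s t. a \<le> s \<and> s < t \<and> t \<le> a + l \<and> (t - s) / 2 \<le> q (f t - f s)"
proof -
  obtain g g' where g: "Lip_C1 g g'" "\<And>t. t \<notin> {0<..<1} \<Longrightarrow> g t = 0 \<and> g' t = 0"
    "\<And>t. q (g' t) \<le> \<epsilon>" "\<And>s t. q (g t - g s) \<le> \<bar>t - s\<bar>"
    "\<exists>s t. 0 \<le> s \<and> s < t \<and> t \<le> 1 \<and> (t - s) / 2 \<le> q (g t - g s)"
    by (rule unit_bump[OF assms(1,2)]) blast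
  define f where "f t = l *\<^sub>R g ((t - a) / l)" for t
  define f' where "f' t = g' ((t - a) / l)" for t
  have diff: "q (f t - f s) = l * q (g ((t - a) / l) - g ((s - a) / l))" for s t
    using assms(3) by (simp add: f_def q_scaleR flip: scaleR_diff_right)
  show ?thesis
  proof (rule that)
    have "Lip_C1 (\<lambda>t. l *\<^sub>R g (1/l * t + (- a / l))) (\<lambda>t. l *\<^sub>R ((1/l) *\<^sub>R g' (1/l * t + (- a / l))))"
      using g(1) assms(3) by (intro Lip_C1_scaleR Lip_C1_affine) auto
    then show "Lip_C1 f f'"
      using assms(3) by (simp add: f_def[abs_def] f'_def[abs_def] diff_divide_distrib)
    show "f t = 0 \<and> f' t = 0" if "t \<notin> {a<..<a + l}" for t
    proof -
      have "(t - a) / l \<notin> {0<..<1}"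
        using that assms(3) by (auto simp: field_simps)
      then show ?thesis using g(2) by (simp add: f_def f'_def)
    qed
    show "q (f' t) \<le> \<epsilon>" for t
      using g(3) by (simp add: f'_def)
    show "q (f t - f s) \<le> \<bar>t - s\<bar>" for s t
    proof -
      have "q (f t - f s) \<le> l * \<bar>(t - a) / l - (s - a) / l\<bar>"
        unfolding diff using g(4) assms(3) by (intro mult_left_mono) auto
      also have "\<dots> = \<bar>t - s\<bar>"
        using assms(3) by (simp flip: diff_divide_distrib)
      finally show ?thesis .
    qed
    obtain s t where st: "0 \<le> s" "s < t" "t \<le> 1" "(t - s) / 2 \<le> q (g t - g s)"
      using g(5) by blast
    show "\<exists>s t. a \<le> s \<and> s < t \<and> t \<le> a + l \<and> (t - s) / 2 \<le> q (f t - f s)"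
    proof (intro exI conjI)
      show "a \<le> a + l * s" "a + l * s < a + l * t" "a + l * t \<le> a + l"
        using st assms(3) by auto
      show "(a + l * t - (a + l * s)) / 2 \<le> q (f (a + l * t) - f (a + l * s))"
        unfolding diff using mult_left_mono[OF st(4), of l] assms(3) by (simp add: algebra_simps)
    qed
  qed
qed

section \<open>Continuity, and gluing of bumps that accumulate at the origin\<close>

lemma continuous_map_quasi_topology_iff:
  "continuous_map (top_of_set S) (quasi_topology q) f \<longleftrightarrow> (\<forall>t\<in>S. qlim f (f t) (at t within S))"
proof -
  have "atin (top_of_set S) t = at t within S" if "t \<in> S" for t
    using that by (auto simp: filter_eq_iff eventually_atin_within eventually_at_topological
        atin_subtopology_within)
  then show ?thesis
    by (simp add: continuous_map_atin limitin_iff_qlim)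
qed

text \<open>A 1-Lipschitz bump supported on an interval of length \<open>(a n)\<^sup>2\<close> has
  size at most \<open>(a n)\<^sup>2\<close>, so the sum is of order \<open>t\<^sup>2\<close> near
  \<open>0\<close> and has derivative \<open>0\<close> there. Away from \<open>0\<close> the sum is
  locally finite.\<close>

lemma Lip_C1_gluing:
  fixes a :: "nat \<Rightarrow> real"
  assumes a: "a \<longlonglongrightarrow> 0" "\<And>n. 0 < a n" "\<And>n. a n < 1" "\<And>m n. m < n \<Longrightarrow> 2 * a n \<le> a m"
    and g: "\<And>n. Lip_C1 (g n) (g' n)"
      "\<And>n t. t \<notin> {a n<..<a n + (a n)\<^sup>2} \<Longrightarrow> g n t = 0 \<and> g' n t = 0"
      "\<And>n t. q (g' n t) \<le> a n" "\<And>n s t. q (g n t - g n s) \<le> \<bar>t - s\<bar>"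
  obtains f f' where "Lip_C1 f f'" "f 0 = 0" "f' 0 = 0"
    "\<And>n t. t \<in> {a n..a n + (a n)\<^sup>2} \<Longrightarrow> f t = g n t"
proof -
  \<comment> \<open>These intervals contain the supports because \<open>(a n)\<^sup>2 < a n\<close>.
    Being half-open, they stay disjoint even if \<open>2 * a n = a m\<close>.\<close>
  define J where "J n = {a n..<2 * a n}" for n
  \<comment> \<open>Each \<open>t\<close> lies in at most one \<open>J n\<close>, so the sums have at most one term.\<close>
  define f where "f t = (\<Sum>n\<in>{n. t \<in> J n}. g n t)" for t
  define f' where "f' t = (\<Sum>n\<in>{n. t \<in> J n}. g' n t)" for t
  have a2: "(a n)\<^sup>2 < a n" for n
    using a(2,3)[of n] mult_strict_left_mono[of "a n" 1 "a n"] by (simp add: power2_eq_square)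
  have zero: "g n t = 0 \<and> g' n t = 0" if "t \<notin> J n" for n t
    using that g(2)[of t n] a2[of n] by (auto simp: J_def)
  have unique: "m = n" if "t \<in> J m" "t \<in> J n" for m n t
    using that a(4)[of m n] a(4)[of n m] by (cases m n rule: linorder_cases) (auto simp: J_def)
  have eq: "f t = g n t \<and> f' t = g' n t" if "t \<in> J n" for n t
  proof -
    have "{n. t \<in> J n} = {n}" using unique that by auto
    then show ?thesis by (simp add: f_def f'_def)
  qed
  have eq_0: "f t = 0 \<and> f' t = 0" if "\<And>n. t \<notin> J n" for t
    using that by (simp add: f_def f'_def)
  have f_near_0: "q (f t) \<le> t\<^sup>2" "q (f' t) \<le> \<bar>t\<bar>" for t
  proof -
    have "q (f t) \<le> t\<^sup>2 \<and> q (f' t) \<le> \<bar>t\<bar>"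
    proof (cases "\<exists>n. t \<in> J n")
      case True
      then obtain n where n: "t \<in> J n" by blast
      then have t: "a n \<le> t" by (simp add: J_def)
      \<comment> \<open>The bump vanishes at \<open>a n\<close>, which is within
        \<open>(a n)\<^sup>2\<close> of every point of its support.\<close>
      have "q (g n t) \<le> (a n)\<^sup>2"
      proof (cases "t \<in> {a n<..<a n + (a n)\<^sup>2}")
        case True
        then show ?thesis using g(4)[of n t "a n"] g(2)[of "a n" n] by auto
      next
        case False
        then show ?thesis using g(2) by simp
      qed
      also have "\<dots> \<le> t\<^sup>2"
        using t a(2)[of n] by (intro power_mono) auto
      finally show ?thesis
        using eq[OF n] g(3)[of n t] t by simp
    next
      case False
      then show ?thesis using eq_0 by simp
    qed
    then show "q (f t) \<le> t\<^sup>2" "q (f' t) \<le> \<bar>t\<bar>" by auto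
  qed
  have J_pos: "0 < t" if "t \<in> J n" for t n
    using that a(2)[of n] by (simp add: J_def)
  have f_0: "f 0 = 0" "f' 0 = 0"
    using eq_0[of 0] J_pos[of 0] by auto
  \<comment> \<open>For points in different intervals, each bump vanishes at the other point, so
    both values are at most \<open>\<bar>t - s\<bar>\<close>. A single use of the quasi-triangle
    inequality then gives \<open>2 * k\<close>, independently of the number of bumps.\<close>
  have Lip: "q (f t - f s) \<le> (2 * k) * \<bar>t - s\<bar>" for s t
  proof -
    have one: "q (f t - f s) \<le> \<bar>t - s\<bar>" if "t \<in> J n" "\<And>m. s \<in> J m \<Longrightarrow> m = n" for s t n
    proof (cases "s \<in> J n")
      case True
      then show ?thesis using eq[OF that(1)] eq[of s n] g(4)[of n t s] by simp
    next
      case False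
      then have "f s = 0" using that eq_0 by blast
      then show ?thesis using False eq[OF that(1)] g(4)[of n t s] zero[of s n] by simp
    qed
    have k: "\<bar>t - s\<bar> \<le> (2 * k) * \<bar>t - s\<bar>"
      using mult_right_mono[of 1 "2 * k" "\<bar>t - s\<bar>"] k_ge_1 by simp
    show ?thesis
    proof (cases "\<exists>n m. t \<in> J n \<and> s \<in> J m \<and> n \<noteq> m")
      case True
      then obtain n m where nm: "t \<in> J n" "s \<in> J m" "n \<noteq> m" by blast
      then have "s \<notin> J n" "t \<notin> J m" using unique by blast+
      then have "q (f t) \<le> \<bar>t - s\<bar>" "q (f s) \<le> \<bar>t - s\<bar>"
        using g(4)[of n t s] g(4)[of m s t] zero[of s n] zero[of t m] eq[OF nm(1)] eq[OF nm(2)]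
        by (simp_all add: abs_minus_commute)
      then have "k * (q (f t) + q (f s)) \<le> k * (\<bar>t - s\<bar> + \<bar>t - s\<bar>)"
        using k_ge_1 by (intro mult_left_mono add_mono) auto
      then show ?thesis using q_diff[of "f t" "f s"] by (simp add: mult_ac)
    next
      case False
      consider n where "t \<in> J n" | n where "s \<in> J n" "\<And>n. t \<notin> J n" | "\<And>n. t \<notin> J n" "\<And>n. s \<notin> J n"
        by blast
      then show ?thesis
      proof cases
        case 1
        then have "q (f t - f s) \<le> \<bar>t - s\<bar>"
          using one[of t n s] False by blast
        then show ?thesis using k by linarith
      next
        case 2
        then have "q (f s - f t) \<le> \<bar>s - t\<bar>"
          using one[of s n t] by blast
        then show ?thesis using k by (simp add: q_minus_commute[of "f t"] abs_minus_commute)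
      next
        case 3
        then show ?thesis using eq_0[of t] eq_0[of s] k_ge_1 by simp
      qed
    qed
  qed
  have away: "qlim (\<lambda>s. (f s - f t) /\<^sub>R (s - t)) (f' t) (at t) \<and> qlim f' (f' t) (at t)" if "t \<noteq> 0" for t
  proof -
    \<comment> \<open>Since \<open>J n\<close> ends at \<open>2 * a n\<close>, this bound keeps all
      later intervals below \<open>\<bar>t\<bar> / 2\<close>, hence away from the neighbourhood
      \<open>S\<close> of \<open>t\<close>.\<close>
    have "\<forall>\<^sub>F n in sequentially. a n < \<bar>t\<bar> / 4"
      using order_tendstoD(2)[OF a(1), of "\<bar>t\<bar> / 4"] that by simp
    then obtain N where N: "\<And>n. n \<ge> N \<Longrightarrow> a n < \<bar>t\<bar> / 4"
      by (auto simp: eventually_sequentially)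
    define S where "S = {s. \<bar>t\<bar> / 2 < \<bar>s\<bar>}"
    have "open S"
      unfolding S_def by (intro open_Collect_less continuous_intros)
    moreover have "t \<in> S" using that by (simp add: S_def)
    ultimately have ev: "\<forall>\<^sub>F s in at t. s \<in> S"
      by (simp add: eventually_at_in_open')
    have fin: "f s = (\<Sum>n<N. g n s) \<and> f' s = (\<Sum>n<N. g' n s)" if "s \<in> S" for s
    proof -
      have sub: "{n. s \<in> J n} \<subseteq> {..<N}"
      proof
        fix n assume "n \<in> {n. s \<in> J n}"
        then have "\<bar>s\<bar> < 2 * a n" using J_pos[of s n] by (auto simp: J_def)
        then have "\<not> a n < \<bar>t\<bar> / 4" using that by (simp add: S_def)
        then show "n \<in> {..<N}" using N[of n] by (cases "n < N") auto
      qed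
      show ?thesis
        unfolding f_def f'_def using sub zero by (auto intro!: sum.mono_neutral_left)
    qed
    have "Lip_C1 (\<lambda>s. \<Sum>n<N. g n s) (\<lambda>s. \<Sum>n<N. g' n s)"
      by (intro Lip_C1_sum g)
    then have "qlim (\<lambda>s. ((\<Sum>n<N. g n s) - (\<Sum>n<N. g n t)) /\<^sub>R (s - t)) (\<Sum>n<N. g' n t) (at t)"
      "qlim (\<lambda>s. \<Sum>n<N. g' n s) (\<Sum>n<N. g' n t) (at t)"
      unfolding Lip_C1_def by blast+
    moreover have "qlim (\<lambda>s. (f s - f t) /\<^sub>R (s - t)) (f' t) (at t) \<longleftrightarrow>
        qlim (\<lambda>s. ((\<Sum>n<N. g n s) - (\<Sum>n<N. g n t)) /\<^sub>R (s - t)) (\<Sum>n<N. g' n t) (at t)"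
      using fin \<open>t \<in> S\<close> by (intro qlim_cong eventually_mono[OF ev]) auto
    moreover have "qlim f' (f' t) (at t) \<longleftrightarrow> qlim (\<lambda>s. \<Sum>n<N. g' n s) (\<Sum>n<N. g' n t) (at t)"
      using fin \<open>t \<in> S\<close> by (intro qlim_cong eventually_mono[OF ev]) auto
    ultimately show ?thesis by blast
  qed
  have abs_0: "((\<lambda>s::real. \<bar>s\<bar>) \<longlongrightarrow> 0) (at 0)"
    by (auto intro!: tendsto_eq_intros)
  have "q (f s /\<^sub>R s) \<le> \<bar>s\<bar>" for s
  proof (cases "s = 0")
    case False
    have "q (f s) \<le> \<bar>s\<bar> * \<bar>s\<bar>"
      using f_near_0(1)[of s] by (simp add: power2_eq_square)
    then show ?thesis
      using False by (simp add: q_scaleR divide_simps)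
  qed simp
  then have "qlim (\<lambda>s. (f s - f 0) /\<^sub>R (s - 0)) (f' 0) (at 0)"
    unfolding qlim_def f_0 by (intro tendsto_sandwich[OF _ _ tendsto_const abs_0]) auto
  moreover have "qlim f' (f' 0) (at 0)"
    unfolding qlim_def f_0 using f_near_0(2) by (intro tendsto_sandwich[OF _ _ tendsto_const abs_0]) auto
  ultimately have "Lip_C1 f f'"
    unfolding Lip_C1_def using Lip away by metis
  moreover have "f t = g n t" if "t \<in> {a n..a n + (a n)\<^sup>2}" for n t
    using that a2[of n] eq[of t n] by (auto simp: J_def)
  ultimately show ?thesis using f_0 that by blast
qed

section \<open>The counterexample on the unit interval\<close>

text \<open>Two-sided limits restrict to limits within \<open>{0..1}\<close>. No point of that
  interval is isolated, so limits are unique there and \<open>THE\<close> picks out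
  \<open>f'\<close>.\<close>

lemma Lip_C1_restrict:
  assumes "Lip_C1 f f'" "f 0 = 0"
  defines "h \<equiv> restrict f {0..1}"
  shows "h \<in> C1_Lip q" "t \<in> {0..1} \<Longrightarrow> quasi_deriv q h t = f' t"
proof -
  have der: "has_quasi_derivative q h (f' t) t" if "t \<in> {0..1}" for t
  proof -
    have "qlim (\<lambda>s. (f s - f t) /\<^sub>R (s - t)) (f' t) (at t)"
      using assms(1) unfolding Lip_C1_def by blast
    then have "qlim (\<lambda>s. (f s - f t) /\<^sub>R (s - t)) (f' t) (at t within {0..1})"
      by (rule qlim_mono) (simp add: at_le)
    moreover have "\<forall>\<^sub>F s in at t within {0..1}. (f s - f t) /\<^sub>R (s - t) = (h s - h t) /\<^sub>R (s - t)"
      using that by (auto simp: h_def eventually_at_filter)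
    ultimately show ?thesis
      unfolding has_quasi_derivative_def limitin_iff_qlim by (simp only: qlim_cong[OF _ refl])
  qed
  have deriv: "quasi_deriv q h t = f' t" if "t \<in> {0..1}" for t
    unfolding quasi_deriv_def
  proof (rule the_equality)
    show "has_quasi_derivative q h (f' t) t" by (rule der[OF that])
    fix D assume "has_quasi_derivative q h D t"
    moreover have "at t within {0..1} \<noteq> bot"
      using that by (auto simp: trivial_limit_within islimpt_Icc)
    ultimately show "D = f' t"
      using der[OF that] unfolding has_quasi_derivative_def limitin_iff_qlim by (intro qlim_unique)
  qed
  then show "t \<in> {0..1} \<Longrightarrow> quasi_deriv q h t = f' t" .
  have "continuous_map (top_of_set {0..1}) (quasi_topology q) (quasi_deriv q h)"
    unfolding continuous_map_quasi_topology_iff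
  proof
    fix t :: real assume t: "t \<in> {0..1}"
    have "qlim f' (f' t) (at t)"
      using assms(1) unfolding Lip_C1_def by blast
    then have "qlim f' (f' t) (at t within {0..1})"
      by (rule qlim_mono) (simp add: at_le)
    moreover have "\<forall>\<^sub>F s in at t within {0..1}. f' s = quasi_deriv q h s"
      by (auto simp: deriv eventually_at_filter)
    ultimately show "qlim (quasi_deriv q h) (quasi_deriv q h t) (at t within {0..1})"
      unfolding deriv[OF t] by (simp only: qlim_cong[OF _ refl])
  qed
  moreover have "\<forall>t\<in>{0..1}. \<exists>D. has_quasi_derivative q h D t"
    using der by blast
  ultimately have "h \<in> C1 q"
    using assms(2) unfolding C1_def by (simp add: h_def)
  moreover obtain L where L: "\<And>s t. q (f t - f s) \<le> L * \<bar>t - s\<bar>"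
    using assms(1) unfolding Lip_C1_def by blast
  have "bdd_above {q (h t - h s) / (t - s) | s t. 0 \<le> s \<and> s < t \<and> t \<le> 1}"
  proof (rule bdd_aboveI[of _ L], clarify)
    fix s t :: real assume "0 \<le> s" "s < t" "t \<le> 1"
    then show "q (h t - h s) / (t - s) \<le> L"
      using L[of t s] by (simp add: h_def pos_divide_le_eq)
  qed
  ultimately show "h \<in> C1_Lip q"
    unfolding C1_Lip_def by blast
qed

lemma C1_Lip_not_Kal:
  assumes "\<not> locally_convex (quasi_topology q)"
  obtains h where "h \<in> C1_Lip q" "h \<notin> C1_Kal q"
proof -
  \<comment> \<open>The shift by \<open>Suc\<close> gives \<open>a n\<close> at most
    \<open>1/2\<close>, so every bump fits into \<open>[0,1]\<close>.\<close>
  define a :: "nat \<Rightarrow> real" where "a n = (1/2) ^ Suc n" for n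
  have a_lim: "a \<longlonglongrightarrow> 0"
    unfolding a_def by (rule LIMSEQ_Suc) (simp add: LIMSEQ_realpow_zero)
  have a_pos: "0 < a n" for n
    by (simp add: a_def)
  have a_le: "a n \<le> 1/2" for n
    unfolding a_def using power_decreasing[of 1 "Suc n" "1/2::real"] by simp
  have a_half: "2 * a n \<le> a m" if "m < n" for m n
    unfolding a_def using power_decreasing[of "Suc m" n "1/2::real"] that by simp
  have "\<forall>n. \<exists>g g'. Lip_C1 g g' \<and> (\<forall>t. t \<notin> {a n<..<a n + (a n)\<^sup>2} \<longrightarrow> g t = 0 \<and> g' t = 0) \<and>
      (\<forall>t. q (g' t) \<le> a n) \<and> (\<forall>s t. q (g t - g s) \<le> \<bar>t - s\<bar>) \<and>
      (\<exists>s t. a n \<le> s \<and> s < t \<and> t \<le> a n + (a n)\<^sup>2 \<and> (t - s) / 2 \<le> q (g t - g s))"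
  proof
    fix n
    have "0 < (a n)\<^sup>2" using a_pos[of n] by simp
    from bump[OF assms a_pos[of n] this, where a = "a n"]
    show "\<exists>g g'. Lip_C1 g g' \<and> (\<forall>t. t \<notin> {a n<..<a n + (a n)\<^sup>2} \<longrightarrow> g t = 0 \<and> g' t = 0) \<and>
      (\<forall>t. q (g' t) \<le> a n) \<and> (\<forall>s t. q (g t - g s) \<le> \<bar>t - s\<bar>) \<and>
      (\<exists>s t. a n \<le> s \<and> s < t \<and> t \<le> a n + (a n)\<^sup>2 \<and> (t - s) / 2 \<le> q (g t - g s))"
      by metis
  qed
  then obtain g g' where g: "\<And>n. Lip_C1 (g n) (g' n)"
      "\<And>n t. t \<notin> {a n<..<a n + (a n)\<^sup>2} \<Longrightarrow> g n t = 0 \<and> g' n t = 0"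
      "\<And>n t. q (g' n t) \<le> a n" "\<And>n s t. q (g n t - g n s) \<le> \<bar>t - s\<bar>"
    and "\<And>n. \<exists>s t. a n \<le> s \<and> s < t \<and> t \<le> a n + (a n)\<^sup>2 \<and> (t - s) / 2 \<le> q (g n t - g n s)"
    by metis
  then obtain u v where uv: "\<And>n. a n \<le> u n" "\<And>n. u n < v n" "\<And>n. v n \<le> a n + (a n)\<^sup>2"
      "\<And>n. (v n - u n) / 2 \<le> q (g n (v n) - g n (u n))"
    by metis
  have a_lt_1: "a n < 1" for n using a_le[of n] by simp
  obtain f f' where f: "Lip_C1 f f'" "f 0 = 0" "f' 0 = 0"
    "\<And>n t. t \<in> {a n..a n + (a n)\<^sup>2} \<Longrightarrow> f t = g n t"
    using Lip_C1_gluing[OF a_lim a_pos a_lt_1 a_half g] by blast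
  define h where "h = restrict f {0..1}"
  have h: "h \<in> C1_Lip q" "quasi_deriv q h 0 = 0"
    using Lip_C1_restrict[OF f(1,2)] f(3) by (simp_all add: h_def)
  have a2: "a n + (a n)\<^sup>2 \<le> 2 * a n" "a n + (a n)\<^sup>2 \<le> 1" for n
  proof -
    have "(a n)\<^sup>2 \<le> a n / 2"
      using mult_left_mono[OF a_le[of n], of "a n"] a_pos[of n] by (simp add: power2_eq_square)
    then show "a n + (a n)\<^sup>2 \<le> 2 * a n" "a n + (a n)\<^sup>2 \<le> 1"
      using a_le[of n] a_pos[of n] by linarith+
  qed
  have uv_range: "0 < u n" "u n < v n" "v n \<le> 2 * a n" "v n \<le> 1" for n
    using uv[of n] a_pos[of n] a2[of n] by linarith+
  \<comment> \<open>These quotients stay large although the pairs \<open>(v n, u n)\<close> tend to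
    \<open>(0, 0)\<close>, where the value is the derivative \<open>0\<close>.\<close>
  have big: "1/2 \<le> q (diff_quotient q h (v n, u n))" for n
  proof -
    have "h (v n) = g n (v n)" "h (u n) = g n (u n)"
      using uv[of n] uv_range[of n] f(4)[of "v n" n] f(4)[of "u n" n] by (auto simp: h_def)
    then show ?thesis
      using uv(2,4)[of n] by (simp add: diff_quotient_def q_scaleR divide_simps mult.commute)
  qed
  have "h \<notin> C1_Kal q"
  proof
    assume "h \<in> C1_Kal q"
    then have "qlim (diff_quotient q h) (diff_quotient q h (0, 0)) (at (0, 0) within {0..1} \<times> {0..1})"
      unfolding C1_Kal_def continuous_map_quasi_topology_iff by simp
    moreover have "filterlim (\<lambda>n. (v n, u n)) (at (0, 0) within {0..1} \<times> {0..1}) sequentially"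
      unfolding filterlim_at
    proof
      have *: "(\<lambda>n. 2 * a n) \<longlonglongrightarrow> 0"
        using tendsto_mult_left[OF a_lim, of 2] by simp
      have "0 \<le> u n" "u n \<le> 2 * a n" "0 \<le> v n" "v n \<le> 2 * a n" for n
        using uv_range[of n] by linarith+
      then have "v \<longlonglongrightarrow> 0" "u \<longlonglongrightarrow> 0"
        by (auto intro!: tendsto_sandwich[OF _ _ tendsto_const *] always_eventually)
      then show "(\<lambda>n. (v n, u n)) \<longlonglongrightarrow> (0, 0)"
        by (rule tendsto_Pair)
      have "(v n, u n) \<in> {0..1} \<times> {0..1} \<and> (v n, u n) \<noteq> (0, 0)" for n
        using uv_range[of n] by auto
      then show "\<forall>\<^sub>F n in sequentially. (v n, u n) \<in> {0..1} \<times> {0..1} \<and> (v n, u n) \<noteq> (0, 0)"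
        by simp
    qed
    ultimately have "qlim (\<lambda>n. diff_quotient q h (v n, u n)) (diff_quotient q h (0, 0)) sequentially"
      by (rule qlim_compose)
    \<comment> \<open>The value at the origin is \<open>quasi_deriv q h 0 = 0\<close>, so the
      distance to the limit is \<open>q\<close> of the quotient itself.\<close>
    then have "(\<lambda>n. q (diff_quotient q h (v n, u n))) \<longlonglongrightarrow> 0"
      unfolding qlim_def by (simp add: diff_quotient_def h(2))
    then have "1/2 \<le> (0::real)"
      by (rule tendsto_lowerbound) (use big in auto)
    then show False by simp
  qed
  then show ?thesis using that h by blast
qed

end

theorem mainTheorem5:
  fixes q :: "'a::real_vector \<Rightarrow> real"
  assumes "quasi_Banach q"
    and "\<not> locally_convex (quasi_topology q)"
  shows "C1_Kal q \<subset> C1_Lip q"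
proof -
  obtain k where "k \<ge> 1" "\<And>x y. q (x + y) \<le> k * (q x + q y)"
    "\<And>x. x \<noteq> 0 \<Longrightarrow> 0 < q x" "\<And>a x. q (a *\<^sub>R x) = \<bar>a\<bar> * q x"
    using assms(1) unfolding quasi_Banach_def quasi_norm_def by metis
  then interpret quasi_normed q k
    by unfold_locales
  obtain h where "h \<in> C1_Lip q" "h \<notin> C1_Kal q"
    using C1_Lip_not_Kal[OF assms(2)] .
  then show ?thesis
    unfolding C1_Kal_def by blast
qed

end
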